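(* Let $n$ be a positive integer, $\rho\ge 0$ a constant, and $p=\frac{\rho\log n}{n}$. (1) If $\rho>1$ then, with high probability, a random graph drawn from $\mathcal{G}(n,p)$ is connected. (2) If $\rho<1$ then, with high probability, a random graph drawn from $\mathcal{G}(n,p)$ has at least one isolated node, thus being disconnected.
   Context: $\mathcal{G}(n,p)$ is the Erdős–Rényi model: a random graph on $n$ nodes in which each of the $\binom n2$ edges appears independently with probability $p$ ($n$ is taken large enough that $p\le1$). An isolated node is a node of degree zero. An event $\mathcal{E}$ (depending on $n$) happens with high probability when $\mathbb{P}[\mathcal{E}]=1-n^{-\Omega(1)}$ as $n\to\infty$, i.e. $\mathbb{P}[\mathcal E]\ge 1-n^{-\kappa}$ for some constant $\kappa>0$ and all large $n$. *)

theory Defs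
  imports "HOL-Probability.Probability" "Graph_Theory.Graph_Theory"
begin

definition possible_edges :: "nat \<Rightarrow> nat set set" where
  "possible_edges n = {e. e \<subseteq> {..<n} \<and> card e = 2}"

text \<open>
  Undirected simple graphs are symmetric loop-free digraphs, the convention of the
  Graph\_Theory library: the edge \<open>{u, v}\<close> is represented by the two arcs \<open>(u, v)\<close> and \<open>(v, u)\<close>.
\<close>
definition graph_of_edges :: "nat \<Rightarrow> nat set set \<Rightarrow> nat pair_pre_digraph" where
  "graph_of_edges n E = \<lparr> pverts = {..<n}, parcs = {(u, v). {u, v} \<in> E} \<rparr>"

text \<open>
  One independent coin per possible edge. Note that \<^const>\<open>bernoulli_pmf\<close> truncates its
  parameter to the unit interval, so \<open>erdos_renyi n p\<close> is the model of the literature only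
  for \<open>0 \<le> p \<le> 1\<close>.
\<close>
definition erdos_renyi :: "nat \<Rightarrow> real \<Rightarrow> nat pair_pre_digraph pmf" where
  "erdos_renyi n p =
     map_pmf (\<lambda>c. graph_of_edges n {e \<in> possible_edges n. c e})
       (Pi_pmf (possible_edges n) False (\<lambda>_. bernoulli_pmf p))"

text \<open>In a symmetric digraph the out-degree of a node is its degree in the undirected graph.\<close>
definition isolated_node :: "'a pair_pre_digraph \<Rightarrow> 'a \<Rightarrow> bool" where
  "isolated_node G v \<longleftrightarrow> v \<in> pverts G \<and> out_degree (with_proj G) v = 0"

text \<open>The exponent \<open>\<kappa>\<close> is chosen before \<open>n\<close>.\<close>
definition with_high_probability :: "(nat \<Rightarrow> 'a pmf) \<Rightarrow> (nat \<Rightarrow> 'a set) \<Rightarrow> bool" where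
  "with_high_probability M A \<longleftrightarrow>
     (\<exists>\<kappa>>0. \<forall>\<^sub>F n in sequentially.
        measure_pmf.prob (M n) (A n) \<ge> 1 - real n powr (- \<kappa>))"

lemma finite_possible_edges: "finite (possible_edges n)"
  unfolding possible_edges_def by (rule finite_subset[of _ "Pow {..<n}"]) auto

lemma pair_graph_graph_of_edges:
  assumes "E \<subseteq> possible_edges n"
  shows "pair_graph (graph_of_edges n E)"
proof -
  have *: "u < n \<and> v < n \<and> u \<noteq> v" if "{u, v} \<in> E" for u v
    using that assms unfolding possible_edges_def by (cases "u = v") auto
  have fin: "finite {(u, v). {u, v} \<in> E}"
    by (rule finite_subset[of _ "{..<n} \<times> {..<n}"]) (use * in auto)
  show ?thesis
  proof
    show "symmetric (with_proj (graph_of_edges n E))"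
      by (auto simp: graph_of_edges_def symmetric_def insert_commute intro!: symI)
  qed (use * fin in \<open>auto simp: graph_of_edges_def split: prod.splits dest!: *\<close>)
qed

lemma pair_graph_erdos_renyi: "G \<in> set_pmf (erdos_renyi n p) \<Longrightarrow> pair_graph G"
  unfolding erdos_renyi_def by (auto intro!: pair_graph_graph_of_edges)

lemma prob_erdos_renyi_edge_set:
  assumes "0 \<le> p" "p \<le> 1" "E \<subseteq> possible_edges n"
  shows "pmf (erdos_renyi n p) (graph_of_edges n E) =
           p ^ card E * (1 - p) ^ (card (possible_edges n) - card E)"
proof -
  let ?P = "possible_edges n"
  let ?g = "\<lambda>c. graph_of_edges n {e \<in> ?P. c e}"
  have inj: "A = B" if "A \<subseteq> ?P" "B \<subseteq> ?P" "graph_of_edges n A = graph_of_edges n B" for A B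
  proof (rule set_eqI)
    fix e
    have iff: "{u, v} \<in> A \<longleftrightarrow> {u, v} \<in> B" for u v
      using that(3) by (auto simp: graph_of_edges_def set_eq_iff)
    show "e \<in> A \<longleftrightarrow> e \<in> B"
    proof (cases "e \<in> ?P")
      case True
      then obtain u v where "e = {u, v}" by (auto simp: possible_edges_def card_2_iff)
      then show ?thesis using iff by simp
    qed (use that in auto)
  qed
  let ?M = "Pi_pmf ?P False (\<lambda>_. bernoulli_pmf p)"
  have "pmf (erdos_renyi n p) (graph_of_edges n E) =
          measure_pmf.prob ?M (?g -` {graph_of_edges n E})"
    unfolding erdos_renyi_def by (simp add: pmf_map)
  also have "\<dots> = measure_pmf.prob ?M {\<lambda>e. e \<in> E}"
  proof (rule measure_pmf.finite_measure_eq_AE)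
    show "AE c in ?M. c \<in> ?g -` {graph_of_edges n E} \<longleftrightarrow> c \<in> {\<lambda>e. e \<in> E}"
    proof (rule AE_pmfI)
      fix c assume "c \<in> set_pmf ?M"
      then have c: "\<not> c e" if "e \<notin> ?P" for e
        using that set_Pi_pmf_subset[OF finite_possible_edges, of n False "\<lambda>_. bernoulli_pmf p"] by auto
      have "?g c = graph_of_edges n E \<longleftrightarrow> {e \<in> ?P. c e} = E"
        using inj[of "{e \<in> ?P. c e}" E] assms(3) by auto
      also have "\<dots> \<longleftrightarrow> c = (\<lambda>e. e \<in> E)"
        using c assms(3) by (auto simp: fun_eq_iff)
      finally show "c \<in> ?g -` {graph_of_edges n E} \<longleftrightarrow> c \<in> {\<lambda>e. e \<in> E}" by simp
    qed
  qed auto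
  also have "\<dots> = pmf ?M (\<lambda>e. e \<in> E)"
    by (simp add: measure_pmf_single)
  also have "\<dots> = (\<Prod>e\<in>?P. pmf (bernoulli_pmf p) (e \<in> E))"
    using assms(3) by (subst pmf_Pi[OF finite_possible_edges]) auto
  also have "\<dots> = (\<Prod>e\<in>?P. if e \<in> E then p else 1 - p)"
    using assms by (intro prod.cong) auto
  also have "\<dots> = p ^ card (?P \<inter> E) * (1 - p) ^ card (?P - E)"
    by (simp add: prod.If_cases[OF finite_possible_edges] Collect_mem_eq Diff_eq)
  also have "?P \<inter> E = E" using assms(3) by auto
  also have "card (?P - E) = card ?P - card E"
    using assms(3) finite_possible_edges by (intro card_Diff_subset) (auto intro: finite_subset)
  finally show ?thesis .
qed

end

theory Submission
  imports Defs "HOL-Real_Asymp.Real_Asymp"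
begin

text \<open>
  Both claims are statements about the random edge set missing a prescribed set of possible edges,
  namely a cut: a graph is connected iff it has an edge across every nontrivial cut, and a node
  \<open>v\<close> is isolated iff no edge crosses the cut \<open>{v}\<close>. A fixed set of \<open>m\<close> possible edges is missed
  with probability \<open>(1 - p)\<^sup>m\<close> (\<open>prob_random_edges_avoid\<close>), and a node set of size \<open>k\<close> cuts
  \<open>k (n - k)\<close> possible edges.

  Above the threshold the first moment suffices. One of the two sides of a cut has at most \<open>n/2\<close>
  nodes, so the probability of being disconnected is at most the sum over \<open>1 \<le> k \<le> n/2\<close> of
  \<open>n choose k\<close> times the \<open>k (n - k)\<close>-th power of \<open>1 - p\<close> (\<open>prob_disconnected_le\<close>). For \<open>\<rho> > 1\<close> there is
  some \<open>\<delta> > 0\<close> such that each summand is at most the \<open>k\<close>-th power of \<open>n\<close> to the \<open>- \<delta>\<close>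
  (\<open>cut_term_le\<close>). The sum is therefore dominated by a geometric series, whose first term
  \<open>k = 1\<close> reflects that isolated nodes are the main obstruction to connectivity.

  Below the threshold the number of isolated nodes has expectation \<open>\<mu> = n (1 - p)\<^sup>n\<^sup>-\<^sup>1\<close>, which is
  about \<open>n\<^sup>1\<^sup>-\<^sup>\<rho>\<close> and hence polynomially large. Two distinct nodes are almost independently
  isolated, as their cuts share only the edge between them. Chebyshev's inequality thus bounds the
  probability that no node is isolated by \<open>1/\<mu> + p/(1 - p)\<close> (\<open>prob_no_isolated_node_le\<close>),
  which decays polynomially.
\<close>

section \<open>Cuts and connectivity\<close>

definition cut_edges :: "nat \<Rightarrow> nat set \<Rightarrow> nat set set" where
  "cut_edges n S = {e \<in> possible_edges n. e \<inter> S \<noteq> {} \<and> e - S \<noteq> {}}"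

lemma finite_cut_edges: "finite (cut_edges n S)"
  unfolding cut_edges_def using finite_possible_edges by simp

lemma cut_edges_subset: "cut_edges n S \<subseteq> possible_edges n"
  unfolding cut_edges_def by simp

lemma cut_edges_compl: "cut_edges n ({..<n} - S) = cut_edges n S"
  unfolding cut_edges_def possible_edges_def by blast

lemma doubleton_in_cut_edges_iff:
  "{u, v} \<in> cut_edges n S \<longleftrightarrow> u < n \<and> v < n \<and> (u \<in> S \<longleftrightarrow> v \<notin> S)"
  by (cases "u = v") (auto simp: cut_edges_def possible_edges_def)

lemma card_cut_edges:
  assumes "S \<subseteq> {..<n}"
  shows "card (cut_edges n S) = card S * (n - card S)"
proof -
  have "cut_edges n S = (\<lambda>(u, v). {u, v}) ` (S \<times> ({..<n} - S))"
  proof (intro equalityI subsetI)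
    fix e assume e: "e \<in> cut_edges n S"
    then obtain x y where "e = {x, y}"
      by (auto simp: cut_edges_def possible_edges_def card_2_iff)
    with e show "e \<in> (\<lambda>(u, v). {u, v}) ` (S \<times> ({..<n} - S))"
      by (cases "x \<in> S") (auto simp: doubleton_in_cut_edges_iff insert_commute image_iff)
  qed (use assms in \<open>auto simp: doubleton_in_cut_edges_iff\<close>)
  moreover have "inj_on (\<lambda>(u, v). {u, v}) (S \<times> ({..<n} - S))"
    by (auto simp: inj_on_def doubleton_eq_iff)
  moreover have "finite S" using assms by (rule finite_subset) simp
  ultimately show ?thesis
    using assms by (simp add: card_image card_cartesian_product card_Diff_subset)
qed

text \<open>
  The cuts of two single nodes have exactly the edge between these nodes in common, so their union
  is one smaller than the sum of their sizes. This common edge is the only source of dependence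
  between the isolation of two nodes.
\<close>

lemma card_cut_edges_two_nodes:
  assumes "u < n" "v < n" "u \<noteq> v"
  shows "card (cut_edges n {u} \<union> cut_edges n {v}) = 2 * n - 3"
proof -
  have "cut_edges n {u} \<inter> cut_edges n {v} = {{u, v}}"
  proof (intro equalityI subsetI)
    fix e assume "e \<in> cut_edges n {u} \<inter> cut_edges n {v}"
    then have "u \<in> e" "v \<in> e" "card e = 2"
      by (auto simp: cut_edges_def possible_edges_def)
    with \<open>u \<noteq> v\<close> show "e \<in> {{u, v}}" by (auto simp: card_2_iff)
  qed (use assms in \<open>auto simp: doubleton_in_cut_edges_iff\<close>)
  moreover have "card (cut_edges n {w}) = n - 1" if "w < n" for w
    using card_cut_edges[of "{w}" n] that by simp
  ultimately show ?thesis
    using card_Un_Int[OF finite_cut_edges finite_cut_edges, of n "{u}" n "{v}"] assms by simp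
qed

text \<open>
  A path from inside \<open>S\<close> to outside \<open>S\<close> must use an edge across the cut. Conversely, no edge leaves
  the set of nodes reachable from a given node, so if every nontrivial cut is crossed, this set
  consists of all nodes.
\<close>

lemma connected_iff_cut_edges:
  assumes "E \<subseteq> possible_edges n" "0 < n"
  shows "Digraph_Component.connected (with_proj (graph_of_edges n E)) \<longleftrightarrow>
    (\<forall>S. S \<noteq> {} \<and> S \<subset> {..<n} \<longrightarrow> E \<inter> cut_edges n S \<noteq> {})"
    (is "?C \<longleftrightarrow> ?R")
proof -
  have parcs: "parcs (mk_symmetric (graph_of_edges n E)) = {(u, v). {u, v} \<in> E}"
    by (auto simp: parcs_mk_symmetric graph_of_edges_def insert_commute)
  let ?R' = "rtrancl_on {..<n} {(u, v). {u, v} \<in> E}"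
  have conn: "?C \<longleftrightarrow> (\<forall>u<n. \<forall>v<n. (u, v) \<in> ?R')"
    using assms(2)
    by (auto simp: connected_def strongly_connected_def reachable_def parcs)
       (auto simp: graph_of_edges_def)
  show ?thesis
  proof
    assume C: ?C
    show ?R
    proof (intro allI impI notI)
      fix S assume S: "S \<noteq> {} \<and> S \<subset> {..<n}" and none: "E \<inter> cut_edges n S = {}"
      obtain u v where uv: "u \<in> S" "u < n" "v < n" "v \<notin> S" using S by auto
      with C conn have "(u, v) \<in> ?R'" by blast
      then have "v \<in> S"
      proof (induction rule: rtrancl_on_induct)
        case (step y z)
        then have "{y, z} \<notin> cut_edges n S" using none by auto
        with step show ?case by (auto simp: doubleton_in_cut_edges_iff)
      qed (use uv in simp)
      with uv show False by simp
    qed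
  next
    assume R: ?R
    have "(u, v) \<in> ?R'" if uv: "u < n" "v < n" for u v
    proof (rule ccontr)
      assume nuv: "(u, v) \<notin> ?R'"
      define S where "S = {w. (u, w) \<in> ?R'}"
      have "S \<subseteq> {..<n}" unfolding S_def using in_rtrancl_on_in_F(2) by fast
      moreover have "u \<in> S" "v \<notin> S" using uv nuv by (auto simp: S_def)
      ultimately obtain e where e: "e \<in> E" "e \<in> cut_edges n S"
        using R uv by blast
      then obtain x y where xy: "e = {x, y}" "x \<in> S" "y \<notin> S" "y < n"
        using \<open>S \<subseteq> {..<n}\<close>
        by (auto simp: cut_edges_def possible_edges_def card_2_iff)
      then have "(u, y) \<in> ?R'"
        using e by (auto simp: S_def intro: rtrancl_on_into_rtrancl_on)
      with xy show False by (simp add: S_def)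
    qed
    with conn show ?C by blast
  qed
qed

lemma isolated_node_iff_cut_edges:
  assumes "E \<subseteq> possible_edges n"
  shows "isolated_node (graph_of_edges n E) v \<longleftrightarrow> v < n \<and> E \<inter> cut_edges n {v} = {}"
proof -
  interpret pair_graph "graph_of_edges n E"
    using assms by (rule pair_graph_graph_of_edges)
  let ?A = "out_arcs (with_proj (graph_of_edges n E)) v"
  have A: "?A = {(u, w). u = v \<and> {u, w} \<in> E}"
    by (auto simp: out_arcs_def graph_of_edges_def)
  have "out_degree (with_proj (graph_of_edges n E)) v = 0 \<longleftrightarrow> (\<forall>w. {v, w} \<notin> E)"
    using A finite_out_arcs[of v] unfolding out_degree_def by auto
  also have "v < n \<and> \<dots> \<longleftrightarrow> v < n \<and> E \<inter> cut_edges n {v} = {}"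
  proof (intro conj_cong iffI refl)
    assume none: "\<forall>w. {v, w} \<notin> E"
    have False if e: "e \<in> E" "e \<in> cut_edges n {v}" for e
    proof -
      obtain x y where "e = {x, y}" using e
        by (auto simp: cut_edges_def possible_edges_def card_2_iff)
      then show False using none e by (auto simp: cut_edges_def insert_commute)
    qed
    then show "E \<inter> cut_edges n {v} = {}" by blast
  next
    assume none: "E \<inter> cut_edges n {v} = {}"
    show "\<forall>w. {v, w} \<notin> E"
    proof (intro allI notI)
      fix w assume vw: "{v, w} \<in> E"
      then have "{v, w} \<in> possible_edges n" using assms by blast
      then have "{v, w} \<in> cut_edges n {v}"
        by (cases "v = w") (auto simp: possible_edges_def cut_edges_def)
      with vw none show False by blast
    qed
  qed
  finally show ?thesis by (simp add: isolated_node_def graph_of_edges_def)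
qed

section \<open>The random edge set\<close>

definition random_edges :: "nat \<Rightarrow> real \<Rightarrow> nat set set pmf" where
  "random_edges n p = map_pmf (\<lambda>c. {e \<in> possible_edges n. c e})
     (Pi_pmf (possible_edges n) False (\<lambda>_. bernoulli_pmf p))"

lemma erdos_renyi_eq_random_edges:
  "erdos_renyi n p = map_pmf (graph_of_edges n) (random_edges n p)"
  by (simp add: erdos_renyi_def random_edges_def pmf.map_comp o_def)

lemma random_edges_subset: "E \<in> set_pmf (random_edges n p) \<Longrightarrow> E \<subseteq> possible_edges n"
  by (auto simp: random_edges_def)

lemma prob_random_edges_avoid:
  assumes "0 \<le> p" "p \<le> 1" "F \<subseteq> possible_edges n"
  shows "measure_pmf.prob (random_edges n p) {E. E \<inter> F = {}} = (1 - p) ^ card F"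
proof -
  let ?M = "Pi_pmf (possible_edges n) False (\<lambda>_. bernoulli_pmf p)"
  let ?B = "\<lambda>e. if e \<in> F then {False} else UNIV"
  have "measure_pmf.prob (random_edges n p) {E. E \<inter> F = {}} =
      measure_pmf.prob ?M (Pi (possible_edges n) ?B)"
    unfolding random_edges_def measure_map_pmf
    using assms(3) by (intro arg_cong[where f = "measure_pmf.prob ?M"]) (auto split: if_splits)
  also have "\<dots> = (\<Prod>e\<in>possible_edges n. measure_pmf.prob (bernoulli_pmf p) (?B e))"
    by (rule measure_Pi_pmf_Pi[OF finite_possible_edges])
  also have "\<dots> = (\<Prod>e\<in>possible_edges n. if e \<in> F then 1 - p else 1)"
    using assms by (intro prod.cong) (auto simp: measure_pmf_single)
  also have "\<dots> = (1 - p) ^ card F"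
    using assms(3) finite_possible_edges
    by (subst prod.If_cases) (auto simp: Int_absorb1 Int_def[symmetric])
  finally show ?thesis .
qed

section \<open>Above the threshold\<close>

text \<open>
  The union bound over all uncrossed cuts. Passing to the complement allows the restriction to
  sides with at most half of the nodes. It is essential for what follows: for such a side of size
  \<open>k\<close>, at least \<open>k n / 2\<close> edges have to be missed.
\<close>

lemma prob_disconnected_le:
  assumes "0 \<le> p" "p \<le> 1" "0 < n"
  shows "measure_pmf.prob (erdos_renyi n p) {G. \<not> Digraph_Component.connected (with_proj G)}
    \<le> (\<Sum>k\<in>{1..n div 2}. real (n choose k) * (1 - p) ^ (k * (n - k)))"
proof -
  let ?M = "random_edges n p"
  let ?S = "\<lambda>k. {S. S \<subseteq> {..<n} \<and> card S = k}"
  let ?A = "\<lambda>S. {E. E \<inter> cut_edges n S = {}}"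
  have fin: "finite (?S k)" for k by (rule finite_subset[of _ "Pow {..<n}"]) auto
  have "measure_pmf.prob (erdos_renyi n p) {G. \<not> Digraph_Component.connected (with_proj G)}
      = measure_pmf.prob ?M {E. \<not> Digraph_Component.connected (with_proj (graph_of_edges n E))}"
    by (simp add: erdos_renyi_eq_random_edges vimage_def)
  also have "\<dots> \<le> measure_pmf.prob ?M (\<Union>k\<in>{1..n div 2}. \<Union>S\<in>?S k. ?A S)"
  proof (rule measure_pmf.finite_measure_mono_AE)
    show "AE E in ?M. E \<in> {E. \<not> Digraph_Component.connected (with_proj (graph_of_edges n E))}
      \<longrightarrow> E \<in> (\<Union>k\<in>{1..n div 2}. \<Union>S\<in>?S k. ?A S)"
    proof (intro AE_pmfI impI)
      fix E assume E: "E \<in> set_pmf ?M"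
        and "E \<in> {E. \<not> Digraph_Component.connected (with_proj (graph_of_edges n E))}"
      then have "\<not> (\<forall>S. S \<noteq> {} \<and> S \<subset> {..<n} \<longrightarrow> E \<inter> cut_edges n S \<noteq> {})"
        using connected_iff_cut_edges[OF random_edges_subset[OF E] assms(3)] by simp
      then obtain S where S: "S \<noteq> {}" "S \<subset> {..<n}" "E \<inter> cut_edges n S = {}"
        by auto
      define T where "T = (if 2 * card S \<le> n then S else {..<n} - S)"
      have "card ({..<n} - S) = n - card S"
        using S by (subst card_Diff_subset) (auto intro: finite_subset)
      then have "2 * card T \<le> n" unfolding T_def by auto
      moreover have T: "T \<noteq> {}" "T \<subseteq> {..<n}" "E \<inter> cut_edges n T = {}"
        using S by (auto simp: T_def cut_edges_compl)
      moreover have "finite T" using T(2) by (rule finite_subset) simp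
      then have "card T \<ge> 1" using T(1) by (simp add: Suc_le_eq card_gt_0_iff)
      ultimately show "E \<in> (\<Union>k\<in>{1..n div 2}. \<Union>S\<in>?S k. ?A S)"
        by (intro UN_I[of "card T"] UN_I[of T]) auto
    qed
  qed simp
  also have "\<dots> \<le> (\<Sum>k\<in>{1..n div 2}. \<Sum>S\<in>?S k. measure_pmf.prob ?M (?A S))"
  proof -
    have inner: "measure_pmf.prob ?M (\<Union>S\<in>?S k. ?A S) \<le> (\<Sum>S\<in>?S k. measure_pmf.prob ?M (?A S))" for k
      by (rule measure_UNION_le[OF fin]) simp
    have "measure_pmf.prob ?M (\<Union>k\<in>{1..n div 2}. \<Union>S\<in>?S k. ?A S)
        \<le> (\<Sum>k\<in>{1..n div 2}. measure_pmf.prob ?M (\<Union>S\<in>?S k. ?A S))"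
      by (rule measure_UNION_le) simp_all
    also have "\<dots> \<le> (\<Sum>k\<in>{1..n div 2}. \<Sum>S\<in>?S k. measure_pmf.prob ?M (?A S))"
      by (rule sum_mono) (rule inner)
    finally show ?thesis .
  qed
  also have "\<dots> = (\<Sum>k\<in>{1..n div 2}. \<Sum>S\<in>?S k. (1 - p) ^ (k * (n - k)))"
    using assms
    by (intro sum.cong refl) (auto simp: prob_random_edges_avoid cut_edges_subset card_cut_edges)
  also have "\<dots> = (\<Sum>k\<in>{1..n div 2}. real (n choose k) * (1 - p) ^ (k * (n - k)))"
    using n_subsets[of "{..<n}"] by simp
  finally show ?thesis .
qed

text \<open>
  With \<open>L = ln n\<close> and \<open>t = 1 - k/n\<close> (so \<open>t \<ge> 1/2\<close>), the probability of missing the cut is at most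
  \<open>exp (- k \<rho> L t)\<close>. Bounding the binomial coefficient by \<open>n\<^sup>k = exp (k L)\<close> gives decay only if
  \<open>\<rho> t > 1\<close>, which may fail for \<open>t\<close> near \<open>1/2\<close>, so this bound is used only for \<open>k \<le> \<epsilon> n\<close>, where
  \<open>\<rho> t - 1 \<ge> \<rho> (1 - \<epsilon>) - 1\<close>. If \<open>k > \<epsilon> n\<close>, then the bound \<open>2\<^sup>n\<close> is at most the \<open>k\<close>-th power of
  the constant \<open>exp (ln 2 / \<epsilon>)\<close>, and for large \<open>n\<close> this costs at most half of the available \<open>\<rho> L / 2\<close>.
\<close>

lemma cut_term_le:
  fixes \<rho> \<epsilon> \<delta> :: real
  assumes "0 < \<rho>" "0 < \<epsilon>" "\<delta> \<le> \<rho> * (1 - \<epsilon>) - 1" "\<delta> \<le> \<rho> / 4"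
    and "0 < n" "\<rho> * ln (real n) / real n \<le> 1" "ln 2 / \<epsilon> \<le> \<rho> / 4 * ln (real n)"
    and "k \<le> n div 2"
  shows "real (n choose k) * (1 - \<rho> * ln (real n) / real n) ^ (k * (n - k))
    \<le> (real n powr - \<delta>) ^ k"
proof -
  define L where "L = ln (real n)"
  define p where "p = \<rho> * L / real n"
  define t where "t = real (n - k) / real n"
  have L: "L \<ge> 0" using assms by (simp add: L_def)
  have t: "t = 1 - real k / real n" "t \<ge> 1 / 2"
    using assms by (auto simp: t_def field_simps of_nat_diff)
  have "(1 - p) ^ (k * (n - k)) \<le> exp (- p) ^ (k * (n - k))"
    using assms exp_ge_add_one_self[of "-p"] by (intro power_mono) (auto simp: p_def L_def)
  also have "\<dots> = exp (- (real k * (\<rho> * L * t)))"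
    by (simp add: exp_of_nat_mult[symmetric] p_def t_def)
  finally have miss: "(1 - p) ^ (k * (n - k)) \<le> exp (- (real k * (\<rho> * L * t)))" .
  \<comment> \<open>The number \<open>b\<close> is the logarithm per node of the bound on the binomial coefficient.\<close>
  have "\<exists>b. real (n choose k) \<le> exp (real k * b) \<and> b - \<rho> * L * t \<le> - \<delta> * L"
  proof (cases "real k \<le> \<epsilon> * real n")
    case True
    have "real (n choose k) \<le> real (n ^ k)"
      using assms by (intro of_nat_mono binomial_le_pow) auto
    also have "\<dots> = exp (real k * L)"
      using assms by (simp add: L_def exp_of_nat_mult)
    finally have "real (n choose k) \<le> exp (real k * L)" .
    moreover have "1 - \<epsilon> \<le> t" using True assms by (simp add: t field_simps)
    then have "\<rho> * (1 - \<epsilon>) \<le> \<rho> * t" using assms by simp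
    with assms have "\<delta> \<le> \<rho> * t - 1" by linarith
    then have "\<delta> * L \<le> (\<rho> * t - 1) * L" using L by (rule mult_right_mono)
    ultimately show ?thesis by (intro exI[of _ L]) (auto simp: algebra_simps)
  next
    case False
    have "n choose k \<le> 2 ^ n"
      by (metis binomial_eq_0_iff binomial_le_pow2 zero_le_numeral)
    then have "real (n choose k) \<le> 2 ^ n"
      by (metis of_nat_le_iff of_nat_numeral of_nat_power)
    also have "(2::real) ^ n = exp (real n * ln 2)"
      by (simp add: exp_of_nat_mult)
    also have "real n \<le> real k / \<epsilon>" using False assms by (simp add: field_simps)
    then have "exp (real n * ln 2) \<le> exp (real k / \<epsilon> * ln 2)"
      unfolding exp_le_cancel_iff by (rule mult_right_mono) simp
    also have "real k / \<epsilon> * ln 2 = real k * (ln 2 / \<epsilon>)" by simp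
    finally have "real (n choose k) \<le> exp (real k * (ln 2 / \<epsilon>))" .
    moreover have "\<rho> * L * (1 / 2) \<le> \<rho> * L * t"
      using t(2) L assms(1) by (intro mult_left_mono) auto
    moreover have "\<delta> * L \<le> \<rho> / 4 * L"
      using L assms(4) by (intro mult_right_mono)
    moreover have "ln 2 / \<epsilon> \<le> \<rho> / 4 * L"
      using assms(7) by (simp only: L_def)
    ultimately have "ln 2 / \<epsilon> - \<rho> * L * t \<le> - \<delta> * L"
      unfolding mult_minus_left times_divide_eq_left times_divide_eq_right by linarith
    with \<open>real (n choose k) \<le> exp (real k * (ln 2 / \<epsilon>))\<close> show ?thesis by blast
  qed
  then obtain b where b: "real (n choose k) \<le> exp (real k * b)" "b - \<rho> * L * t \<le> - \<delta> * L"
    by blast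
  have "real (n choose k) * (1 - p) ^ (k * (n - k))
      \<le> exp (real k * b) * exp (- (real k * (\<rho> * L * t)))"
    using b(1) miss assms by (intro mult_mono) (auto simp: p_def L_def)
  also have "\<dots> = exp (real k * (b - \<rho> * L * t))"
    by (simp add: exp_add[symmetric] algebra_simps)
  also have "\<dots> \<le> exp (real k * (- \<delta> * L))"
    unfolding exp_le_cancel_iff using b(2) by (rule mult_left_mono) simp
  also have "\<dots> = (real n powr - \<delta>) ^ k"
    using assms by (simp add: powr_def L_def exp_of_nat_mult[symmetric])
  finally show ?thesis by (simp add: p_def L_def)
qed

lemma sum_power_le_twice:
  fixes x :: real
  assumes "0 \<le> x" "x \<le> 1 / 2"
  shows "(\<Sum>k\<in>{1..m}. x ^ k) \<le> 2 * x"
proof -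
  have shift: "(\<Sum>k\<in>{1..m}. x ^ k) = x * (\<Sum>k<m. x ^ k)"
    by (simp add: sum_distrib_left lessThan_atLeast0 sum.shift_bounds_cl_Suc_ivl
        sum.atLeast1_atMost_eq)
  have "(\<Sum>k<m. x ^ k) = (1 - x ^ m) / (1 - x)"
    using assms by (subst sum_gp_strict) auto
  also have "\<dots> \<le> 1 / (1 / 2)"
    using assms zero_le_power[OF assms(1), of m] by (intro frac_le) auto
  finally have "(\<Sum>k<m. x ^ k) \<le> 2" by simp
  from mult_left_mono[OF this assms(1)] show ?thesis unfolding shift by (simp only: mult.commute)
qed

lemma whp_connected:
  fixes \<rho> :: real
  assumes "\<rho> > 1"
  shows "with_high_probability (\<lambda>n. erdos_renyi n (\<rho> * ln (real n) / real n))
    (\<lambda>n. {G. Digraph_Component.connected (with_proj G)})"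
proof -
  \<comment> \<open>The choice of \<open>\<epsilon>\<close> places \<open>\<rho> (1 - \<epsilon>)\<close> halfway between \<open>1\<close> and \<open>\<rho>\<close>.\<close>
  define \<epsilon> where "\<epsilon> = (\<rho> - 1) / (2 * \<rho>)"
  define \<delta> where "\<delta> = min ((\<rho> - 1) / 2) (\<rho> / 4)"
  have \<epsilon>: "\<epsilon> > 0" and \<delta>: "\<delta> > 0" using assms by (auto simp: \<epsilon>_def \<delta>_def)
  have "\<rho> * (1 - \<epsilon>) - 1 = (\<rho> - 1) / 2"
    using assms by (simp add: \<epsilon>_def field_simps)
  then have \<delta>1: "\<delta> \<le> \<rho> * (1 - \<epsilon>) - 1" and \<delta>2: "\<delta> \<le> \<rho> / 4"
    unfolding \<delta>_def by (simp_all only: min.cobounded1 min.cobounded2)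
  have "\<forall>\<^sub>F n in sequentially. ln 2 / \<epsilon> \<le> \<rho> / 4 * ln (real n)" using assms by real_asymp
  moreover have "\<forall>\<^sub>F n in sequentially. \<rho> * ln (real n) / real n \<le> 1" using assms by real_asymp
  moreover have "\<forall>\<^sub>F n in sequentially. real n powr - \<delta> \<le> 1 / 2" using \<delta> by real_asymp
  \<comment> \<open>Halving the exponent absorbs the factor \<open>2\<close> from the geometric series.\<close>
  moreover have "\<forall>\<^sub>F n in sequentially. 2 * real n powr - \<delta> \<le> real n powr - (\<delta> / 2)"
    using \<delta> by real_asymp
  moreover have "\<forall>\<^sub>F n in sequentially. n > (0::nat)" by (rule eventually_gt_at_top)
  ultimately have "\<forall>\<^sub>F n in sequentially. measure_pmf.prob (erdos_renyi n (\<rho> * ln (real n) / real n))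
      {G. Digraph_Component.connected (with_proj G)} \<ge> 1 - real n powr - (\<delta> / 2)"
  proof eventually_elim
    case (elim n)
    let ?p = "\<rho> * ln (real n) / real n"
    let ?G = "erdos_renyi n ?p"
    have p: "0 \<le> ?p" "?p \<le> 1" using elim assms by auto
    have "measure_pmf.prob ?G {G. \<not> Digraph_Component.connected (with_proj G)}
        \<le> (\<Sum>k\<in>{1..n div 2}. real (n choose k) * (1 - ?p) ^ (k * (n - k)))"
      using p elim by (intro prob_disconnected_le) auto
    also have "\<dots> \<le> (\<Sum>k\<in>{1..n div 2}. (real n powr - \<delta>) ^ k)"
      using assms \<epsilon> \<delta>1 \<delta>2 elim by (intro sum_mono cut_term_le) auto
    also have "\<dots> \<le> 2 * real n powr - \<delta>"
      using elim by (intro sum_power_le_twice) auto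
    finally have "measure_pmf.prob ?G {G. \<not> Digraph_Component.connected (with_proj G)}
        \<le> real n powr - (\<delta> / 2)" using elim by linarith
    then show ?case
      using measure_pmf.prob_neg[where P = "\<lambda>G. Digraph_Component.connected (with_proj G)" and M = ?G] by simp
  qed
  with \<delta> show ?thesis unfolding with_high_probability_def by (intro exI[of _ "\<delta> / 2"]) auto
qed

section \<open>Below the threshold\<close>

text \<open>
  The second moment method: if none of the events occurs, then the number \<open>X\<close> of occurring events
  deviates from its expectation \<open>\<mu>\<close> by at least \<open>\<mu>\<close>, which Chebyshev's inequality bounds by
  \<open>Var X / \<mu>\<^sup>2\<close>. The double sum is the expectation of \<open>X\<^sup>2\<close>.
\<close>

lemma (in prob_space) prob_no_event_le:
  assumes "finite I" "\<And>i. i \<in> I \<Longrightarrow> A i \<in> events"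
    and "(\<Sum>i\<in>I. prob (A i)) > 0"
  shows "prob {x \<in> space M. \<forall>i\<in>I. x \<notin> A i}
    \<le> (\<Sum>i\<in>I. \<Sum>j\<in>I. prob (A i \<inter> A j)) / (\<Sum>i\<in>I. prob (A i))\<^sup>2 - 1"
proof -
  define X where "X x = (\<Sum>i\<in>I. indicator (A i) x :: real)" for x
  define \<mu> where "\<mu> = (\<Sum>i\<in>I. prob (A i))"
  have [measurable]: "A i \<in> events" if "i \<in> I" for i using assms that by auto
  have square: "(X x)\<^sup>2 = (\<Sum>i\<in>I. \<Sum>j\<in>I. indicator (A i \<inter> A j) x)" for x
    by (simp add: X_def power2_eq_square sum_product indicator_inter_arith)
  have ind: "integrable M (indicator B :: _ \<Rightarrow> real)" if "B \<in> events" for B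
    using that by (simp add: integrable_indicator_iff emeasure_eq_measure)
  have X: "integrable M X"
    unfolding X_def using assms by (auto intro!: ind)
  have EX: "expectation X = \<mu>"
    unfolding X_def \<mu>_def using assms sets.sets_into_space
    by (subst Bochner_Integration.integral_sum) (auto intro!: ind sum.cong simp: Int_absorb2)
  have X2: "integrable M (\<lambda>x. (X x)\<^sup>2)"
    unfolding square using assms by (intro Bochner_Integration.integrable_sum ind) auto
  have EX2: "expectation (\<lambda>x. (X x)\<^sup>2) = (\<Sum>i\<in>I. \<Sum>j\<in>I. prob (A i \<inter> A j))"
  proof -
    have "expectation (\<lambda>x. (X x)\<^sup>2) =
        (\<Sum>i\<in>I. \<Sum>j\<in>I. expectation (indicator (A i \<inter> A j)))"
      unfolding square using assms
      by (simp add: Bochner_Integration.integral_sum Bochner_Integration.integrable_sum ind)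
    also have "\<dots> = (\<Sum>i\<in>I. \<Sum>j\<in>I. prob (A i \<inter> A j))"
      using assms sets.sets_into_space
      by (intro sum.cong refl) (auto intro!: arg_cong[where f = prob])
    finally show ?thesis .
  qed
  have "prob {x \<in> space M. \<forall>i\<in>I. x \<notin> A i} \<le> prob {x \<in> space M. \<mu> \<le> \<bar>X x - expectation X\<bar>}"
    using X by (intro finite_measure_mono) (auto simp: EX X_def)
  also have "\<dots> \<le> variance X / \<mu>\<^sup>2"
    using X X2 assms(3) by (intro Chebyshev_inequality) (auto simp: \<mu>_def)
  also have "variance X = (\<Sum>i\<in>I. \<Sum>j\<in>I. prob (A i \<inter> A j)) - \<mu>\<^sup>2"
    using variance_eq[OF X X2] by (simp add: EX EX2)
  also have "\<dots> / \<mu>\<^sup>2 = (\<Sum>i\<in>I. \<Sum>j\<in>I. prob (A i \<inter> A j)) / \<mu>\<^sup>2 - 1"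
    using assms(3) by (simp add: \<mu>_def diff_divide_distrib)
  finally show ?thesis by (simp add: \<mu>_def)
qed

text \<open>
  In the second moment of the number of isolated nodes, the diagonal contributes \<open>1/\<mu>\<close> relative to
  \<open>\<mu>\<^sup>2\<close>. Each off-diagonal pair has probability \<open>r\<^sup>2 / (1 - p)\<close> instead of \<open>r\<^sup>2\<close>, where \<open>r\<close> is the
  probability that a given node is isolated. This excess contributes at most \<open>1 / (1 - p) - 1 = p / (1 - p)\<close>.
\<close>

lemma prob_no_isolated_node_le:
  assumes "0 \<le> p" "p < 1" "2 \<le> n"
  shows "measure_pmf.prob (erdos_renyi n p) {G. \<not> (\<exists>v. isolated_node G v)}
    \<le> 1 / (real n * (1 - p) ^ (n - 1)) + p / (1 - p)"
proof -
  let ?M = "random_edges n p"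
  define q where "q = 1 - p"
  define r where "r = q ^ (n - 1)"
  let ?A = "\<lambda>v. {E. E \<inter> cut_edges n {v} = {}}"
  have q: "q > 0" and r: "r > 0" using assms by (auto simp: q_def r_def)
  have single: "measure_pmf.prob ?M (?A v) = r" if "v < n" for v
    using assms that
    by (simp add: prob_random_edges_avoid cut_edges_subset card_cut_edges q_def r_def)
  have pair: "measure_pmf.prob ?M (?A u \<inter> ?A v) = r\<^sup>2 / q" if "u < n" "v < n" "u \<noteq> v" for u v
  proof -
    have "?A u \<inter> ?A v = {E. E \<inter> (cut_edges n {u} \<union> cut_edges n {v}) = {}}" by auto
    then have "measure_pmf.prob ?M (?A u \<inter> ?A v) = q ^ (2 * n - 3)"
      using assms that cut_edges_subset
      by (simp add: prob_random_edges_avoid card_cut_edges_two_nodes q_def del: Int_Un_distrib)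
    also have "(2 * n - 3) + 1 = (n - 1) * 2" using assms by simp
    then have "q ^ (2 * n - 3) * q = r\<^sup>2"
      unfolding r_def power_mult[symmetric] by (metis power_add power_one_right)
    then have "q ^ (2 * n - 3) = r\<^sup>2 / q" using q by (simp add: field_simps)
    finally show ?thesis .
  qed
  have mean: "(\<Sum>v<n. measure_pmf.prob ?M (?A v)) = n * r"
    by (simp add: single)
  have row: "(\<Sum>v<n. measure_pmf.prob ?M (?A u \<inter> ?A v)) = r + real (n - 1) * (r\<^sup>2 / q)" if "u < n" for u
  proof -
    have "(\<Sum>v<n. measure_pmf.prob ?M (?A u \<inter> ?A v)) =
        measure_pmf.prob ?M (?A u \<inter> ?A u) + (\<Sum>v\<in>{..<n} - {u}. measure_pmf.prob ?M (?A u \<inter> ?A v))"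
      using that by (subst sum.remove[of _ u]) auto
    also have "(\<Sum>v\<in>{..<n} - {u}. measure_pmf.prob ?M (?A u \<inter> ?A v)) = real (n - 1) * (r\<^sup>2 / q)"
      using that by (simp add: pair)
    finally show ?thesis using single[OF that] by simp
  qed
  have "measure_pmf.prob (erdos_renyi n p) {G. \<not> (\<exists>v. isolated_node G v)}
      = measure_pmf.prob ?M {E. \<not> (\<exists>v. isolated_node (graph_of_edges n E) v)}"
    by (simp add: erdos_renyi_eq_random_edges vimage_def)
  also have "\<dots> = measure_pmf.prob ?M {E. \<forall>v\<in>{..<n}. E \<notin> ?A v}"
    by (intro measure_pmf.finite_measure_eq_AE AE_pmfI)
       (auto dest!: random_edges_subset simp: isolated_node_iff_cut_edges)
  also have "\<dots> \<le> (\<Sum>u<n. \<Sum>v<n. measure_pmf.prob ?M (?A u \<inter> ?A v)) / (n * r)\<^sup>2 - 1"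
    using measure_pmf.prob_no_event_le[of "{..<n}" ?A ?M] assms r
    unfolding mean by simp
  also have "\<dots> = n * (r + real (n - 1) * (r\<^sup>2 / q)) / (n * r)\<^sup>2 - 1"
    using assms by (simp add: row of_nat_diff)
  also have "\<dots> = 1 / (n * r) + real (n - 1) / n / q - 1"
  proof -
    have "x * (r + y * (r\<^sup>2 / q)) / (x * r)\<^sup>2 = 1 / (x * r) + y / x / q" if "x > 0" for x y
      using r q that by (simp add: field_simps power2_eq_square)
    from this[of "real n" "real (n - 1)"] show ?thesis using assms by linarith
  qed
  also have "\<dots> \<le> 1 / (n * r) + 1 / q - 1"
    using q assms by (intro diff_right_mono add_left_mono divide_right_mono) auto
  finally have "measure_pmf.prob (erdos_renyi n p) {G. \<not> (\<exists>v. isolated_node G v)}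
    \<le> 1 / (n * r) + 1 / q - 1" .
  moreover have "1 / q - 1 = p / (1 - p)"
    using q by (simp add: q_def field_simps)
  ultimately show ?thesis unfolding r_def q_def by linarith
qed

text \<open>
  Since \<open>n (1 - p)\<^sup>n\<close> is asymptotic to \<open>n\<^sup>1\<^sup>-\<^sup>\<rho>\<close>, the first summand is of order \<open>n\<close> to the \<open>- 2 \<kappa>\<close>.
  The second is at most of order \<open>(ln n)/n\<close>. Both decay faster than \<open>n\<close> to the \<open>- \<kappa>\<close>, so
  each is eventually below half of it.
\<close>

lemma eventually_no_isolated_node_bound_le:
  fixes \<rho> \<kappa> :: real
  assumes "\<rho> = 1 - 2 * \<kappa>" "0 < \<kappa>" "\<kappa> < 1"
  shows "\<forall>\<^sub>F n in sequentially. 1 / (real n * (1 - \<rho> * ln (real n) / real n) powr real n)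
      + (\<rho> * ln (real n) / real n) / (1 - \<rho> * ln (real n) / real n) \<le> real n powr - \<kappa>"
proof -
  have "\<forall>\<^sub>F n in sequentially. 1 / (real n * (1 - \<rho> * ln (real n) / real n) powr real n)
      \<le> real n powr - \<kappa> / 2"
    using assms(1,2) by real_asymp
  moreover have "\<forall>\<^sub>F n in sequentially.
      (\<rho> * ln (real n) / real n) / (1 - \<rho> * ln (real n) / real n) \<le> real n powr - \<kappa> / 2"
    using assms(3) by real_asymp
  ultimately show ?thesis by eventually_elim linarith
qed

lemma whp_isolated_node:
  fixes \<rho> :: real
  assumes "0 \<le> \<rho>" "\<rho> < 1"
  shows "with_high_probability (\<lambda>n. erdos_renyi n (\<rho> * ln (real n) / real n))
    (\<lambda>n. {G. (\<exists>v. isolated_node G v) \<and> \<not> Digraph_Component.connected (with_proj G)})"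
proof -
  define \<kappa> where "\<kappa> = (1 - \<rho>) / 2"
  have \<kappa>: "\<rho> = 1 - 2 * \<kappa>" "0 < \<kappa>" "\<kappa> < 1"
    using assms by (auto simp: \<kappa>_def field_simps)
  have "\<forall>\<^sub>F n in sequentially. \<rho> * ln (real n) / real n < 1" by real_asymp
  then have "\<forall>\<^sub>F n in sequentially. measure_pmf.prob (erdos_renyi n (\<rho> * ln (real n) / real n))
      {G. (\<exists>v. isolated_node G v) \<and> \<not> Digraph_Component.connected (with_proj G)}
      \<ge> 1 - real n powr - \<kappa>"
    using eventually_no_isolated_node_bound_le[OF \<kappa>] eventually_ge_at_top[of 2]
  proof eventually_elim
    case (elim n)
    let ?p = "\<rho> * ln (real n) / real n"
    let ?G = "erdos_renyi n ?p"
    have p: "0 \<le> ?p" "?p < 1" using elim assms by auto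
    have disc: "\<not> Digraph_Component.connected (with_proj G)"
      if G: "G \<in> set_pmf ?G" and v: "isolated_node G v" for G v
    proof -
      obtain E where E: "G = graph_of_edges n E" "E \<subseteq> possible_edges n"
        using G random_edges_subset by (auto simp: erdos_renyi_eq_random_edges)
      then have "v < n" "E \<inter> cut_edges n {v} = {}"
        using v isolated_node_iff_cut_edges by auto
      moreover have "{v} \<noteq> {..<n}"
        using elim by (metis card.empty card_insert_disjoint card_lessThan finite.emptyI
            numeral_2_eq_2 Suc_n_not_le_n empty_iff)
      ultimately show ?thesis
        using connected_iff_cut_edges[OF E(2)] elim E(1) by (auto intro!: exI[of _ "{v}"])
    qed
    have "measure_pmf.prob ?G {G. \<not> (\<exists>v. isolated_node G v)}
        \<le> 1 / (real n * (1 - ?p) ^ (n - 1)) + ?p / (1 - ?p)"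
      using p elim by (intro prob_no_isolated_node_le) auto
    also have "\<dots> \<le> 1 / (real n * (1 - ?p) powr real n) + ?p / (1 - ?p)"
    proof -
      have "(1 - ?p) powr real n \<le> (1 - ?p) ^ (n - 1)"
        using p by (subst powr_realpow) (auto intro!: power_decreasing)
      moreover have "(1 - ?p) powr real n > 0" using p(2) unfolding powr_gt_zero by linarith
      ultimately show ?thesis
        using elim by (intro add_right_mono divide_left_mono mult_left_mono mult_pos_pos) auto
    qed
    also have "\<dots> \<le> real n powr - \<kappa>" using elim by simp
    finally have "1 - real n powr - \<kappa> \<le> measure_pmf.prob ?G {G. \<exists>v. isolated_node G v}"
      using measure_pmf.prob_neg[where P = "\<lambda>G. \<exists>v. isolated_node G v" and M = ?G] by simp
    also have "\<dots> = measure_pmf.prob ?G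
        {G. (\<exists>v. isolated_node G v) \<and> \<not> Digraph_Component.connected (with_proj G)}"
      using disc by (intro measure_pmf.finite_measure_eq_AE AE_pmfI) auto
    finally show ?case .
  qed
  with \<kappa>(2) show ?thesis unfolding with_high_probability_def by blast
qed

theorem theorem4p3:
  fixes \<rho> :: real
  assumes "\<rho> \<ge> 0"
  shows "(\<rho> > 1 \<longrightarrow>
            with_high_probability (\<lambda>n. erdos_renyi n (\<rho> * ln (real n) / real n))
              (\<lambda>n. {G. Digraph_Component.connected (with_proj G)})) \<and>
         (\<rho> < 1 \<longrightarrow>
            with_high_probability (\<lambda>n. erdos_renyi n (\<rho> * ln (real n) / real n))
              (\<lambda>n. {G. (\<exists>v. isolated_node G v) \<and> \<not> Digraph_Component.connected (with_proj G)}))"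
  using whp_connected whp_isolated_node assms by blast

end
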